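(* Let $Y\sim \mathrm{TE}(\mu,K^{-1})$ be a transelliptical random vector in $\mathbb{R}^d$, $d\ge2$, with associated strictly increasing functions $f_1,\dots,f_d$, and let $i\neq j$ in $\{1,\dots,d\}$. Then $K_{ij}=0$ if and only if the conditional covariance $\operatorname{cov}(f_i(Y_i),g(Y_j)\mid Y_{(ij)})$ is zero (almost surely) for every function $g$ for which the covariance exists.
   Context: A random vector $X=(X_1,\dots,X_d)$ has an elliptical distribution, written $X\sim E(\mu,\Sigma)$, if its characteristic function has the form $\boldsymbol t\mapsto \phi(\boldsymbol t^T\Sigma \boldsymbol t)\exp(i\mu^T \boldsymbol t)$ for some $\phi:[0,\infty)\to\mathbb{R}$, where $\mu\in\mathbb{R}^d$ and $\Sigma$ is a $d\times d$ symmetric matrix; $\phi$ is left implicit. Standing assumptions: $\Sigma$ is positive definite and, in the stochastic representation $X=\mu+\xi\,\Sigma^{1/2}U$ with $U$ uniform on the unit sphere of $\mathbb{R}^d$, $\xi\ge 0$ and $\xi$ independent of $U$, one has $0<\mathbb{E}\xi^2<\infty$. A random vector $Y$ has a transelliptical distribution, written $Y\sim \mathrm{TE}(\mu,\Sigma)$, if $f(Y):=(f_1(Y_1),\dots,f_d(Y_d))\sim E(\mu,\Sigma)$ for some fixed (deterministic) strictly increasing functions $f_1,\dots,f_d:\mathbb{R}\to\mathbb{R}$. Put $K=\Sigma^{-1}$. $Y_{(ij)}$ denotes $Y$ with the coordinates $Y_i,Y_j$ removed (if $d=2$, conditioning on $Y_{(ij)}$ is no conditioning). Functions $g:\mathbb{R}\to\mathbb{R}$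 are understood to be Borel measurable. *)

theory Defs
  imports "HOL-Probability.Probability"
begin

section \<open>Elliptical and transelliptical random vectors\<close>

definition char_vec :: "'a measure \<Rightarrow> ('a \<Rightarrow> real^'d) \<Rightarrow> real^'d \<Rightarrow> complex" where
  "char_vec M X t = (CLINT \<omega>|M. iexp (t \<bullet> X \<omega>))"

definition elliptical :: "'a measure \<Rightarrow> ('a \<Rightarrow> real^'d) \<Rightarrow> real^'d \<Rightarrow> real^'d^'d \<Rightarrow> bool" where
  "elliptical M X \<mu> \<Sigma> \<longleftrightarrow>
     prob_space M \<and> X \<in> borel_measurable M \<and> transpose \<Sigma> = \<Sigma> \<and>
     (\<exists>\<phi> :: real \<Rightarrow> real. \<forall>t. char_vec M X t =
        complex_of_real (\<phi> (t \<bullet> (\<Sigma> *v t))) * iexp (\<mu> \<bullet> t))"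

definition transelliptical ::
  "'a measure \<Rightarrow> ('a \<Rightarrow> real^'d) \<Rightarrow> ('d \<Rightarrow> real \<Rightarrow> real) \<Rightarrow> real^'d \<Rightarrow> real^'d^'d \<Rightarrow> bool" where
  "transelliptical M Y f \<mu> \<Sigma> \<longleftrightarrow>
     Y \<in> borel_measurable M \<and> (\<forall>k. strict_mono (f k)) \<and>
     elliptical M (\<lambda>\<omega>. \<chi> k. f k (Y \<omega> $ k)) \<mu> \<Sigma>"

definition positive_definite :: "real^'d^'d \<Rightarrow> bool" where
  "positive_definite A \<longleftrightarrow> transpose A = A \<and> (\<forall>x. x \<noteq> 0 \<longrightarrow> 0 < x \<bullet> (A *v x))"

text \<open>
  Normalised surface measure on the unit sphere, as the radial projection of the uniform
  distribution on the unit ball. The centre of the ball, which is not sent to the sphere,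
  is a null set.
\<close>
definition uniform_sphere :: "(real^'d) measure" where
  "uniform_sphere = distr (uniform_measure lborel (ball 0 1)) borel (\<lambda>x. x /\<^sub>R norm x)"

text \<open>
  The stochastic representation \<open>X = \<mu> + \<xi> \<Sigma>\<^sup>1\<^sup>/\<^sup>2 U\<close> in distribution, with
  \<open>0 < E \<xi>\<^sup>2 < \<infinity>\<close>. The matrix \<open>R\<close> is the square root \<open>\<Sigma>\<^sup>1\<^sup>/\<^sup>2\<close>; for positive definite
  \<open>\<Sigma>\<close> it exists and is unique. The type of \<open>N\<close> is no restriction, since every joint
  distribution of \<open>(\<xi>, U)\<close> is a probability measure on \<open>real \<times> real^'d\<close>. Independence is
  stated for the generated sigma-algebras because \<open>indep_var\<close> requires both variables to have
  the same type.
\<close>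
definition square_integrable_radius ::
  "'a measure \<Rightarrow> ('a \<Rightarrow> real^'d) \<Rightarrow> real^'d \<Rightarrow> real^'d^'d \<Rightarrow> bool" where
  "square_integrable_radius M X \<mu> \<Sigma> \<longleftrightarrow>
     (\<exists>(N :: (real \<times> real^'d) measure) \<xi> U R.
        positive_definite R \<and> R ** R = \<Sigma> \<and>
        prob_space N \<and> \<xi> \<in> borel_measurable N \<and> U \<in> borel_measurable N \<and>
        prob_space.indep_set N (sets (vimage_algebra (space N) \<xi> borel))
          (sets (vimage_algebra (space N) U borel)) \<and>
        (AE \<omega> in N. 0 \<le> \<xi> \<omega>) \<and>
        distr N borel U = uniform_sphere \<and>
        distr M borel X = distr N borel (\<lambda>\<omega>. \<mu> + \<xi> \<omega> *\<^sub>R (R *v U \<omega>)) \<and>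
        integrable N (\<lambda>\<omega>. (\<xi> \<omega>)\<^sup>2) \<and> 0 < (LINT \<omega>|N. (\<xi> \<omega>)\<^sup>2))"

section \<open>Conditional covariance\<close>

text \<open>
  The sigma-algebra generated by the coordinates of \<open>Y\<close> other than \<open>i\<close> and \<open>j\<close>.
  If there are none, the target is a one-point space and the sigma-algebra is trivial.
\<close>
definition sigma_without ::
  "'a measure \<Rightarrow> ('a \<Rightarrow> real^'d) \<Rightarrow> 'd \<Rightarrow> 'd \<Rightarrow> 'a measure" where
  "sigma_without M Y i j =
     vimage_algebra (space M) (\<lambda>\<omega>. \<lambda>k\<in>- {i, j}. Y \<omega> $ k) (\<Pi>\<^sub>M k\<in>- {i, j}. borel)"

text \<open>
  \<^const>\<open>real_cond_exp\<close> is the difference of the conditional expectations of the positive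
  and the negative part, so it is the conditional expectation of every \<open>h\<close> below, even if
  \<open>h\<close> is not integrable. Where the expectation does not exist it takes junk values.
\<close>
definition cond_exp_exists :: "'a measure \<Rightarrow> 'a measure \<Rightarrow> ('a \<Rightarrow> real) \<Rightarrow> bool" where
  "cond_exp_exists M F h \<longleftrightarrow>
     h \<in> borel_measurable M \<and> (AE \<omega> in M. nn_cond_exp M F (\<lambda>\<omega>. ennreal \<bar>h \<omega>\<bar>) \<omega> < \<infinity>)"

definition cond_centered :: "'a measure \<Rightarrow> 'a measure \<Rightarrow> ('a \<Rightarrow> real) \<Rightarrow> 'a \<Rightarrow> real" where
  "cond_centered M F A = (\<lambda>\<omega>. A \<omega> - real_cond_exp M F A \<omega>)"

definition cond_cov ::
  "'a measure \<Rightarrow> 'a measure \<Rightarrow> ('a \<Rightarrow> real) \<Rightarrow> ('a \<Rightarrow> real) \<Rightarrow> 'a \<Rightarrow> real" where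
  "cond_cov M F A B =
     real_cond_exp M F (\<lambda>\<omega>. cond_centered M F A \<omega> * cond_centered M F B \<omega>)"

definition cond_cov_exists ::
  "'a measure \<Rightarrow> 'a measure \<Rightarrow> ('a \<Rightarrow> real) \<Rightarrow> ('a \<Rightarrow> real) \<Rightarrow> bool" where
  "cond_cov_exists M F A B \<longleftrightarrow>
     cond_exp_exists M F A \<and> cond_exp_exists M F B \<and>
     cond_exp_exists M F (\<lambda>\<omega>. cond_centered M F A \<omega> * cond_centered M F B \<omega>)"

end

theory Submission
  imports Defs
begin

text \<open>
  Put \<open>X\<^sub>k = f\<^sub>k(Y\<^sub>k)\<close>. Each \<open>f\<^sub>k\<close> is strictly increasing, so \<open>Y\<^sub>k\<close> and \<open>X\<^sub>k\<close> generate the same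
  sigma-algebra, and the claim concerns the elliptical vector \<open>X = \<mu> + \<xi> \<Sigma>\<^sup>1\<^sup>/\<^sup>2 U\<close>.

  The proof rests on a symmetry. Since \<open>U\<close> is invariant under orthogonal maps
  (\<open>distr_uniform_sphere_orthogonal\<close>) and independent of \<open>\<xi>\<close>, the law of \<open>Z = X - \<mu>\<close> is invariant
  under the maps that are orthogonal for the inner product of \<open>K = \<Sigma>\<^sup>-\<^sup>1\<close>, in particular under the
  reflections \<open>z \<mapsto> z - 2 (K z)\<^sub>i / K\<^sub>i\<^sub>i e\<^sub>i\<close>
  (\<open>reflection_symmetric_vector_of_square_integrable_radius\<close>). This reflection changes the sign of
  \<open>W\<^sub>i = (K Z)\<^sub>i\<close> and fixes all coordinates of \<open>X\<close> except the \<open>i\<close>-th. Hence \<open>W\<^sub>i B\<close> has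
  conditional expectation \<open>0\<close> for every function \<open>B\<close> of those coordinates
  (\<open>real_cond_exp_dual_coord\<close>). As \<open>W\<^sub>i\<close> and \<open>W\<^sub>j\<close> are conditionally centered given the
  coordinates outside \<open>{i, j}\<close>, solving for \<open>Z\<^sub>i\<close> and \<open>Z\<^sub>j\<close> yields the centered
  variables \<open>r\<^sub>i = X\<^sub>i - E(X\<^sub>i | Y\<^bsub>(ij)\<^esub>)\<close> and \<open>r\<^sub>j\<close> as combinations of \<open>W\<^sub>i\<close> and \<open>W\<^sub>j\<close>
  (\<open>cond_centered_X\<close>), with \<open>W\<^sub>i = K\<^sub>i\<^sub>i r\<^sub>i + K\<^sub>i\<^sub>j r\<^sub>j\<close>.

  If \<open>K\<^sub>i\<^sub>j = 0\<close> then \<open>r\<^sub>i = W\<^sub>i / K\<^sub>i\<^sub>i\<close>, and its product with the centered \<open>g(Y\<^sub>j)\<close>, a function of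
  the coordinates other than the \<open>i\<close>-th, has conditional expectation \<open>0\<close>. Conversely, take
  \<open>g = f\<^sub>j\<close>; the covariance exists by square integrability, and if it vanishes then
  \<open>E(r\<^sub>i r\<^sub>j) = 0\<close>. Since \<open>r\<^sub>j\<close> is a function of the coordinates other than the \<open>i\<close>-th,
  \<open>0 = E(W\<^sub>i r\<^sub>j) = K\<^sub>i\<^sub>i E(r\<^sub>i r\<^sub>j) + K\<^sub>i\<^sub>j E(r\<^sub>j\<^sup>2) = K\<^sub>i\<^sub>j E(r\<^sub>j\<^sup>2)\<close>. Here \<open>E(r\<^sub>j\<^sup>2) > 0\<close>,
  because \<open>r\<^sub>j\<close> is a nonzero linear function of \<open>Z\<close> and \<open>Z\<close> is concentrated on no hyperplane
  through the origin.
\<close>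

section \<open>Rotation invariance of the uniform distribution on the sphere\<close>

lemma unit_ball_lborel:
  "emeasure lborel (ball (0::'a::euclidean_space) 1) \<noteq> 0"
  "emeasure lborel (ball (0::'a::euclidean_space) 1) < \<infinity>"
  using content_ball_pos[of 1 "0::'a"] emeasure_lborel_ball_finite[of "0::'a" 1]
  by (auto simp: measure_def)

lemma nn_integral_lborel_shift:
  fixes h :: "'a::euclidean_space \<Rightarrow> ennreal"
  assumes [measurable]: "h \<in> borel_measurable borel"
  shows "(\<integral>\<^sup>+x. h (c + x) \<partial>lborel) = (\<integral>\<^sup>+x. h x \<partial>lborel)"
proof -
  have "(\<integral>\<^sup>+x. h x \<partial>lborel) = (\<integral>\<^sup>+x. h x \<partial>distr lborel borel ((+) c))"
    by (simp add: lborel_distr_plus)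
  also have "\<dots> = (\<integral>\<^sup>+x. h (c + x) \<partial>lborel)"
    by (subst nn_integral_distr) auto
  finally show ?thesis ..
qed

text \<open>
  This is the uniqueness argument for Haar measure. For nonnegative \<open>f\<close> and \<open>g\<close>, translation
  invariance and Fubini turn \<open>\<integral>f(x) dx \<cdot> \<integral>g(T y) dy\<close> successively into the double integrals of
  \<open>f(x) g(T y + x)\<close>, \<open>f(x - T y) g(x)\<close> and \<open>f(- T y) g(x)\<close>. If \<open>f\<close> is the indicator of the
  unit ball then \<open>f(- T y) = f(y)\<close>, and its positive finite integral cancels.
\<close>
lemma distr_lborel_orthogonal:
  fixes T :: "'a::euclidean_space \<Rightarrow> 'a"
  assumes T: "orthogonal_transformation T"
  shows "distr lborel borel T = lborel"
proof (rule measure_eqI)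
  have lin: "linear T" and bij: "bij T"
    using T by (auto simp: orthogonal_transformation_linear orthogonal_transformation_bij)
  have [measurable]: "T \<in> borel_measurable borel"
    using lin by (intro borel_measurable_continuous_onI linear_continuous_on linear_conv_bounded_linear[THEN iffD1])
  fix A :: "'a set" assume "A \<in> sets (distr lborel borel T)"
  then have [measurable]: "A \<in> sets borel" by simp
  define f :: "'a \<Rightarrow> ennreal" where "f = indicator (ball 0 1)"
  define g :: "'a \<Rightarrow> ennreal" where "g = indicator A"
  have [measurable]: "f \<in> borel_measurable borel" "g \<in> borel_measurable borel"
    unfolding f_def g_def by (auto intro!: borel_measurable_indicator borel_open)
  have f_T: "f (- T y) = f y" for y
    by (simp add: f_def indicator_def orthogonal_transformation_norm[OF T])
  obtain S where TS: "\<And>x. T (S x) = x"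
    using bij by (metis bij_is_surj surj_f_inv_f)
  have "(\<integral>\<^sup>+x. f x \<partial>lborel) * (\<integral>\<^sup>+y. g (T y) \<partial>lborel)
      = (\<integral>\<^sup>+x. \<integral>\<^sup>+y. f x * g (T y) \<partial>lborel \<partial>lborel)"
    by (simp add: nn_integral_cmult nn_integral_multc)
  (* shift y by the T-preimage of x *)
  also have "\<dots> = (\<integral>\<^sup>+x. \<integral>\<^sup>+y. f x * g (T y + x) \<partial>lborel \<partial>lborel)"
  proof (rule nn_integral_cong)
    fix x :: 'a
    have "(\<integral>\<^sup>+y. f x * g (T (S x + y)) \<partial>lborel) = (\<integral>\<^sup>+y. f x * g (T y) \<partial>lborel)"
      by (rule nn_integral_lborel_shift) measurable
    then show "(\<integral>\<^sup>+y. f x * g (T y) \<partial>lborel) = (\<integral>\<^sup>+y. f x * g (T y + x) \<partial>lborel)"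
      by (simp add: linear_add[OF lin] TS add.commute)
  qed
  also have "\<dots> = (\<integral>\<^sup>+y. \<integral>\<^sup>+x. f x * g (T y + x) \<partial>lborel \<partial>lborel)"
    by (rule lborel_pair.Fubini') measurable
  also have "\<dots> = (\<integral>\<^sup>+y. \<integral>\<^sup>+x. f (x - T y) * g x \<partial>lborel \<partial>lborel)"
  proof (rule nn_integral_cong)
    fix y :: 'a
    have "(\<integral>\<^sup>+x. f (- T y + x) * g (T y + (- T y + x)) \<partial>lborel) = (\<integral>\<^sup>+x. f x * g (T y + x) \<partial>lborel)"
      by (rule nn_integral_lborel_shift[where h = "\<lambda>x. f x * g (T y + x)"]) measurable
    then show "(\<integral>\<^sup>+x. f x * g (T y + x) \<partial>lborel) = (\<integral>\<^sup>+x. f (x - T y) * g x \<partial>lborel)"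
      by (simp add: algebra_simps)
  qed
  also have "\<dots> = (\<integral>\<^sup>+x. \<integral>\<^sup>+y. f (x - T y) * g x \<partial>lborel \<partial>lborel)"
    by (rule lborel_pair.Fubini') measurable
  also have "\<dots> = (\<integral>\<^sup>+x. \<integral>\<^sup>+y. f y * g x \<partial>lborel \<partial>lborel)"
  proof (rule nn_integral_cong)
    fix x :: 'a
    have "(\<integral>\<^sup>+y. f (x - T (S x + y)) * g x \<partial>lborel) = (\<integral>\<^sup>+y. f (x - T y) * g x \<partial>lborel)"
      by (rule nn_integral_lborel_shift) measurable
    then show "(\<integral>\<^sup>+y. f (x - T y) * g x \<partial>lborel) = (\<integral>\<^sup>+y. f y * g x \<partial>lborel)"
      by (simp add: linear_add[OF lin] TS f_T)
  qed
  also have "\<dots> = (\<integral>\<^sup>+x. f x \<partial>lborel) * (\<integral>\<^sup>+y. g y \<partial>lborel)"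
    by (simp add: nn_integral_cmult nn_integral_multc)
  finally have "emeasure lborel (ball (0::'a) 1) * (\<integral>\<^sup>+y. g (T y) \<partial>lborel)
      = emeasure lborel (ball (0::'a) 1) * emeasure lborel A"
    by (simp add: f_def g_def)
  then have "(\<integral>\<^sup>+y. g (T y) \<partial>lborel) = emeasure lborel A"
    using unit_ball_lborel[where 'a = 'a] by (auto simp: ennreal_mult_cancel_left)
  moreover have "(\<integral>\<^sup>+y. g (T y) \<partial>lborel) = (\<integral>\<^sup>+y. g y \<partial>distr lborel borel T)"
    by (subst nn_integral_distr) auto
  ultimately show "emeasure (distr lborel borel T) A = emeasure lborel A"
    by (simp add: g_def)
qed simp

lemma sets_uniform_sphere [simp, measurable_cong]: "sets uniform_sphere = sets borel"
  by (simp add: uniform_sphere_def)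

lemma prob_space_uniform_sphere: "prob_space (uniform_sphere :: (real^'d) measure)"
  unfolding uniform_sphere_def
  by (intro prob_space.prob_space_distr prob_space_uniform_measure)
     (use unit_ball_lborel in \<open>auto simp: less_top\<close>)

lemma AE_uniform_sphereI:
  assumes "Measurable.pred borel P" and "AE x in lborel. P (x /\<^sub>R norm x)"
  shows "AE u in (uniform_sphere :: (real^'d) measure). P u"
proof -
  have [measurable]: "(\<lambda>x::real^'d. x /\<^sub>R norm x) \<in> borel_measurable lborel" by measurable
  show ?thesis
    unfolding uniform_sphere_def using assms
    by (subst AE_distr_iff) (auto intro!: AE_uniform_measureI simp: pred_def)
qed

lemma AE_uniform_sphere_norm: "AE u in (uniform_sphere :: (real^'d) measure). norm u = 1"
proof (rule AE_uniform_sphereI)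
  show "AE x in lborel. norm ((x :: real^'d) /\<^sub>R norm x) = 1"
    using AE_lborel_singleton[of "0::real^'d"] by (auto elim!: eventually_mono)
qed measurable

lemma AE_uniform_sphere_hyperplane:
  fixes w :: "real^'d"
  assumes "w \<noteq> 0"
  shows "AE u in uniform_sphere. w \<bullet> u \<noteq> 0"
proof (rule AE_uniform_sphereI)
  have "negligible {x. w \<bullet> x = 0}"
    using assms by (intro negligible_hyperplane) auto
  then have "{x. w \<bullet> x = 0} \<in> null_sets lebesgue"
    by (simp add: negligible_iff_null_sets)
  then have "AE x in lebesgue. w \<bullet> x \<noteq> 0"
    by (auto dest: AE_not_in)
  then have "AE x in lborel. w \<bullet> x \<noteq> 0"
    by (simp add: AE_completion_iff)
  then show "AE x in lborel. w \<bullet> (x /\<^sub>R norm x) \<noteq> 0"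
    using AE_lborel_singleton[of "0::real^'d"] by eventually_elim auto
qed measurable

lemma distr_uniform_sphere_orthogonal:
  fixes T :: "real^'d \<Rightarrow> real^'d"
  assumes T: "orthogonal_transformation T"
  shows "distr uniform_sphere borel T = uniform_sphere"
proof -
  have lin: "linear T" using T by (simp add: orthogonal_transformation_linear)
  have [measurable]: "T \<in> borel_measurable borel"
    using lin by (intro borel_measurable_continuous_onI linear_continuous_on linear_conv_bounded_linear[THEN iffD1])
  let ?B = "uniform_measure lborel (ball (0::real^'d) 1)"
  have ball: "distr ?B borel T = ?B"
  proof (rule measure_eqI)
    fix A assume "A \<in> sets (distr ?B borel T)"
    then have A[measurable]: "A \<in> sets borel" by simp
    have TA: "T -` A \<in> sets borel" using measurable_sets[OF \<open>T \<in> borel_measurable borel\<close> A] by simp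
    have "ball 0 1 \<inter> T -` A = T -` (ball 0 1 \<inter> A)"
      by (auto simp: orthogonal_transformation_norm[OF T])
    moreover have "emeasure lborel (T -` (ball 0 1 \<inter> A)) = emeasure (distr lborel borel T) (ball 0 1 \<inter> A)"
      by (subst emeasure_distr) auto
    ultimately show "emeasure (distr ?B borel T) A = emeasure ?B A"
      using TA by (simp add: emeasure_distr distr_lborel_orthogonal[OF T])
  qed simp
  have "distr uniform_sphere borel T = distr ?B borel (T \<circ> (\<lambda>x. x /\<^sub>R norm x))"
    unfolding uniform_sphere_def by (rule distr_distr) auto
  also have "T \<circ> (\<lambda>x. x /\<^sub>R norm x) = (\<lambda>x. x /\<^sub>R norm x) \<circ> T"
    by (auto simp: linear_scale[OF lin] orthogonal_transformation_norm[OF T])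
  also have "distr ?B borel \<dots> = distr (distr ?B borel T) borel (\<lambda>x. x /\<^sub>R norm x)"
    by (rule distr_distr[symmetric]) auto
  finally show ?thesis by (simp only: ball uniform_sphere_def)
qed

section \<open>Positive definite matrices and reflections\<close>

lemma borel_measurable_vec_nth [measurable]: "(\<lambda>x::real^'d. x $ i) \<in> borel_measurable borel"
  by (intro borel_measurable_continuous_onI continuous_intros)

lemma borel_measurable_matrix_vector_mult [measurable]:
  "(\<lambda>x::real^'d. (A::real^'d^'d) *v x) \<in> borel_measurable borel"
  by (intro borel_measurable_continuous_onI matrix_vector_mult_linear_continuous_on)

lemma inner_symmetric_matrix:
  fixes A :: "real^'n^'n"
  assumes "transpose A = A"
  shows "x \<bullet> (A *v y) = (A *v x) \<bullet> y"
  by (metis assms dot_lmul_matrix vector_transpose_matrix)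

lemma positive_definite_matrix_inv:
  fixes A :: "real^'n^'n"
  assumes A: "positive_definite A"
  shows "A *v (matrix_inv A *v x) = x" and "positive_definite (matrix_inv A)"
proof -
  have sym: "transpose A = A" and pos: "\<And>x. x \<noteq> 0 \<Longrightarrow> 0 < x \<bullet> (A *v x)"
    using A by (auto simp: positive_definite_def)
  have "inj ((*v) A)"
  proof (rule injI)
    fix x y assume "A *v x = A *v y"
    then have "A *v (x - y) = 0" by (simp add: matrix_vector_mult_diff_distrib)
    then show "x = y" using pos[of "x - y"] by auto
  qed
  then have "invertible A"
    by (metis invertible_left_inverse matrix_left_invertible_injective)
  then have inv: "A ** matrix_inv A = mat 1 \<and> matrix_inv A ** A = mat 1"
    unfolding invertible_def matrix_inv_def by (rule someI_ex)
  then show A_inv: "A *v (matrix_inv A *v x) = x" for x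
    by (simp add: matrix_vector_mul_assoc)
  have "transpose (matrix_inv A) ** A = mat 1"
    using inv by (metis matrix_transpose_mul sym transpose_mat)
  then have "transpose (matrix_inv A) = matrix_inv A"
    by (metis inv matrix_mul_assoc matrix_mul_lid matrix_mul_rid)
  moreover have "0 < x \<bullet> (matrix_inv A *v x)" if "x \<noteq> 0" for x
  proof -
    have "0 < (matrix_inv A *v x) \<bullet> (A *v (matrix_inv A *v x))"
      using that A_inv[of x] by (intro pos) auto
    then show ?thesis by (simp add: A_inv inner_commute)
  qed
  ultimately show "positive_definite (matrix_inv A)"
    by (simp add: positive_definite_def)
qed

lemma positive_definite_diagonal_pos:
  assumes "positive_definite A"
  shows "0 < A $ i $ i"
proof -
  have "0 < axis i 1 \<bullet> (A *v axis i 1)"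
    using assms by (simp add: positive_definite_def axis_eq_0_iff)
  then show ?thesis by (simp add: inner_axis' matrix_vector_mul_component inner_axis)
qed

text \<open>
  The vector \<open>A\<^sub>j\<^sub>j e\<^sub>i - A\<^sub>i\<^sub>j e\<^sub>j\<close> has \<open>A\<close>-energy equal to \<open>A\<^sub>j\<^sub>j\<close> times the minor.
\<close>
lemma positive_definite_minor_pos:
  assumes A: "positive_definite A" and "i \<noteq> j"
  shows "0 < A $ i $ i * A $ j $ j - (A $ i $ j)\<^sup>2"
proof -
  have sym: "A $ j $ i = A $ i $ j"
  proof -
    have "transpose A $ i $ j = A $ i $ j" using A by (simp add: positive_definite_def)
    then show ?thesis by (simp add: transpose_def)
  qed
  define x where "x = A $ j $ j *\<^sub>R axis i (1::real) - A $ i $ j *\<^sub>R axis j 1"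
  have "x $ i = A $ j $ j" using \<open>i \<noteq> j\<close> by (simp add: x_def axis_def)
  then have "x \<noteq> 0" using positive_definite_diagonal_pos[OF A, of j] by auto
  then have "0 < x \<bullet> (A *v x)" using A by (simp add: positive_definite_def)
  also have "x \<bullet> (A *v x) = A $ j $ j * (A $ i $ i * A $ j $ j - (A $ i $ j)\<^sup>2)"
    unfolding x_def
    by (simp add: matrix_vector_mult_diff_distrib matrix_vector_mult_scaleR inner_diff_left
        inner_axis' matrix_vector_mul_component inner_axis sym power2_eq_square algebra_simps)
  finally show ?thesis
    using positive_definite_diagonal_pos[OF A, of j] by (simp add: zero_less_mult_iff)
qed

text \<open>The reflection in the hyperplane orthogonal to \<open>n\<close>; for \<open>n = 0\<close> it is the identity.\<close>
definition householder :: "real^'d \<Rightarrow> real^'d \<Rightarrow> real^'d" where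
  "householder n x = x - (2 * (n \<bullet> x) / (n \<bullet> n)) *\<^sub>R n"

lemma orthogonal_transformation_householder: "orthogonal_transformation (householder n)"
proof (cases "n = 0")
  case True then show ?thesis by (simp add: householder_def[abs_def])
next
  case False
  have "linear (householder n)"
    by (rule linearI) (auto simp: householder_def inner_add_right algebra_simps add_divide_distrib)
  moreover have "householder n x \<bullet> householder n y = x \<bullet> y" for x y
    using False by (simp add: householder_def inner_diff_left inner_diff_right inner_commute field_simps)
  ultimately show ?thesis by (simp add: orthogonal_transformation_def)
qed

section \<open>Reflection symmetry of elliptical vectors\<close>

text \<open>
  Independence of the generated sigma-algebras gives the product formula on rectangles, which
  determine the joint law.
\<close>
lemma joint_law_of_indep_sets:
  assumes "prob_space N" and [measurable]: "\<xi> \<in> borel_measurable N" "U \<in> borel_measurable N"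
    and indep: "prob_space.indep_set N (sets (vimage_algebra (space N) \<xi> borel))
          (sets (vimage_algebra (space N) U borel))"
  shows "distr N borel \<xi> \<Otimes>\<^sub>M distr N borel U = distr N (borel \<Otimes>\<^sub>M borel) (\<lambda>\<omega>. (\<xi> \<omega>, U \<omega>))"
proof -
  interpret prob_space N by fact
  show ?thesis
  proof (rule pair_measure_eqI)
    show "sigma_finite_measure (distr N borel \<xi>)" "sigma_finite_measure (distr N borel U)"
      by (auto intro!: prob_space_imp_sigma_finite prob_space_distr)
    show "sets (distr N borel \<xi> \<Otimes>\<^sub>M distr N borel U)
        = sets (distr N (borel \<Otimes>\<^sub>M borel) (\<lambda>\<omega>. (\<xi> \<omega>, U \<omega>)))"
      by (simp cong: sets_pair_measure_cong)
    fix A B assume "A \<in> sets (distr N borel \<xi>)" "B \<in> sets (distr N borel U)"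
    then have [measurable]: "A \<in> sets borel" "B \<in> sets borel" by auto
    have "prob ((\<xi> -` A \<inter> space N) \<inter> (U -` B \<inter> space N))
        = prob (\<xi> -` A \<inter> space N) * prob (U -` B \<inter> space N)"
      by (rule indep_setD[OF indep]) (auto intro!: in_vimage_algebra)
    moreover have "(\<lambda>\<omega>. (\<xi> \<omega>, U \<omega>)) -` (A \<times> B) \<inter> space N = (\<xi> -` A \<inter> space N) \<inter> (U -` B \<inter> space N)"
      by auto
    ultimately show "emeasure (distr N borel \<xi>) A * emeasure (distr N borel U) B
        = emeasure (distr N (borel \<Otimes>\<^sub>M borel) (\<lambda>\<omega>. (\<xi> \<omega>, U \<omega>))) (A \<times> B)"
      by (simp add: emeasure_distr emeasure_eq_measure ennreal_mult'')
  qed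
qed

text \<open>
  What the proof needs to know about an elliptical vector. The map
  \<open>x \<mapsto> x - 2 (K (x - \<mu>))\<^sub>i / K\<^sub>i\<^sub>i e\<^sub>i\<close> is the reflection about \<open>\<mu>\<close>, orthogonal for the inner
  product of \<open>K\<close>, that reverses the direction \<open>e\<^sub>i\<close>. It changes the \<open>i\<close>-th coordinate of \<open>x\<close>
  only, and it changes the sign of \<open>(K (x - \<mu>))\<^sub>i\<close>.
\<close>
locale reflection_symmetric_vector = prob_space M for M :: "'a measure" +
  fixes X :: "'a \<Rightarrow> real^'d" and \<mu> :: "real^'d" and K :: "real^'d^'d"
  assumes X [measurable]: "X \<in> borel_measurable M"
    and K: "positive_definite K"
    and square_integrable: "integrable M (\<lambda>\<omega>. (norm (X \<omega> - \<mu>))\<^sup>2)"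
    and nondegenerate: "v \<noteq> 0 \<Longrightarrow> \<not> (AE \<omega> in M. v \<bullet> (X \<omega> - \<mu>) = 0)"
    and reflection: "h \<in> borel_measurable borel \<Longrightarrow>
      (\<integral>\<^sup>+\<omega>. h (X \<omega> - (2 * (K *v (X \<omega> - \<mu>)) $ i / K $ i $ i) *\<^sub>R axis i 1) \<partial>M)
        = (\<integral>\<^sup>+\<omega>. (h (X \<omega>) :: ennreal) \<partial>M)"

text \<open>
  In the representation \<open>X = \<mu> + \<xi> R U\<close> the \<open>K\<close>-reflection in direction \<open>e\<^sub>i\<close> becomes the
  Householder reflection of \<open>U\<close> along \<open>n = R K e\<^sub>i\<close>: one has \<open>R n = e\<^sub>i\<close>,
  \<open>n \<bullet> n = K\<^sub>i\<^sub>i\<close> and \<open>(K R u)\<^sub>i = n \<bullet> u\<close>. The law of \<open>U\<close> is invariant under it, and \<open>\<xi>\<close> is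
  independent of \<open>U\<close>.
\<close>
lemma reflection_symmetric_vector_of_square_integrable_radius:
  fixes X :: "'a \<Rightarrow> real^'d"
  assumes "prob_space M" and X[measurable]: "X \<in> borel_measurable M"
    and \<Sigma>: "positive_definite \<Sigma>" and radius: "square_integrable_radius M X \<mu> \<Sigma>"
  shows "reflection_symmetric_vector M X \<mu> (matrix_inv \<Sigma>)"
proof -
  interpret prob_space M by fact
  define K where "K = matrix_inv \<Sigma>"
  obtain N :: "(real \<times> real^'d) measure" and \<xi> U R
    where R: "positive_definite R" "R ** R = \<Sigma>"
      and N: "prob_space N" and \<xi>[measurable]: "\<xi> \<in> borel_measurable N" and U[measurable]: "U \<in> borel_measurable N"
      and indep: "prob_space.indep_set N (sets (vimage_algebra (space N) \<xi> borel))
          (sets (vimage_algebra (space N) U borel))"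
      and U_distr: "distr N borel U = uniform_sphere"
      and X_distr: "distr M borel X = distr N borel (\<lambda>\<omega>. \<mu> + \<xi> \<omega> *\<^sub>R (R *v U \<omega>))"
      and \<xi>_int: "integrable N (\<lambda>\<omega>. (\<xi> \<omega>)\<^sup>2)" and \<xi>_pos: "0 < (LINT \<omega>|N. (\<xi> \<omega>)\<^sup>2)"
    using radius unfolding square_integrable_radius_def by blast
  interpret N: prob_space N by (rule N)
  interpret S: prob_space "uniform_sphere :: (real^'d) measure" by (rule prob_space_uniform_sphere)
  have \<Sigma>_R: "\<Sigma> *v x = R *v (R *v x)" for x
    using R(2) by (simp add: matrix_vector_mul_assoc)
  have K: "positive_definite K" and \<Sigma>_K: "\<And>x. \<Sigma> *v (K *v x) = x"
    using positive_definite_matrix_inv[OF \<Sigma>] by (auto simp: K_def)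
  have K_sym: "transpose K = K" and R_sym: "transpose R = R"
    using K R by (auto simp: positive_definite_def)
  have law: "(\<integral>\<^sup>+\<omega>. h (X \<omega>) \<partial>M) = (\<integral>\<^sup>+r. \<integral>\<^sup>+u. h (\<mu> + r *\<^sub>R (R *v u)) \<partial>uniform_sphere \<partial>distr N borel \<xi>)"
    if [measurable]: "h \<in> borel_measurable borel" for h :: "real^'d \<Rightarrow> ennreal"
  proof -
    have "(\<integral>\<^sup>+\<omega>. h (X \<omega>) \<partial>M) = (\<integral>\<^sup>+x. h x \<partial>distr M borel X)"
      by (simp add: nn_integral_distr)
    also have "\<dots> = (\<integral>\<^sup>+\<omega>. h (\<mu> + \<xi> \<omega> *\<^sub>R (R *v U \<omega>)) \<partial>N)"
      unfolding X_distr by (subst nn_integral_distr) auto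
    also have "\<dots> = (\<integral>\<^sup>+p. h (\<mu> + fst p *\<^sub>R (R *v snd p)) \<partial>distr N (borel \<Otimes>\<^sub>M borel) (\<lambda>\<omega>. (\<xi> \<omega>, U \<omega>)))"
      by (subst nn_integral_distr) auto
    also have "\<dots> = (\<integral>\<^sup>+p. h (\<mu> + fst p *\<^sub>R (R *v snd p)) \<partial>(distr N borel \<xi> \<Otimes>\<^sub>M uniform_sphere))"
      by (simp add: joint_law_of_indep_sets[OF N \<xi> U indep, symmetric] U_distr)
    also have "\<dots> = (\<integral>\<^sup>+r. \<integral>\<^sup>+u. h (\<mu> + r *\<^sub>R (R *v u)) \<partial>uniform_sphere \<partial>distr N borel \<xi>)"
      by (subst S.nn_integral_fst[symmetric]) auto
    finally show ?thesis .
  qed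
  have AE_U: "AE \<omega> in N. P (U \<omega>)" if "AE u in uniform_sphere. P u" "Measurable.pred borel P" for P
  proof -
    have "AE u in distr N borel U. P u" unfolding U_distr by (rule that(1))
    then show ?thesis using that(2) by (subst (asm) AE_distr_iff) (auto simp: pred_def)
  qed
  have AE_X: "(AE \<omega> in M. P (X \<omega>)) \<longleftrightarrow> (AE \<omega> in N. P (\<mu> + \<xi> \<omega> *\<^sub>R (R *v U \<omega>)))"
    if "Measurable.pred borel P" for P
  proof -
    have "{x \<in> space borel. P x} \<in> sets borel" using that by (simp add: pred_def)
    then have "(AE \<omega> in M. P (X \<omega>)) \<longleftrightarrow> (AE x in distr M borel X. P x)"
      "(AE \<omega> in N. P (\<mu> + \<xi> \<omega> *\<^sub>R (R *v U \<omega>))) \<longleftrightarrow> (AE x in distr N borel (\<lambda>\<omega>. \<mu> + \<xi> \<omega> *\<^sub>R (R *v U \<omega>)). P x)"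
      by (subst AE_distr_iff; simp)+
    then show ?thesis unfolding X_distr by simp
  qed
  show ?thesis
    unfolding K_def[symmetric]
  proof unfold_locales
    show "X \<in> borel_measurable M" "positive_definite K" by fact+
  next
    have "bounded_linear ((*v) R)" by (rule matrix_vector_mul_bounded_linear)
    then obtain C where C: "\<And>x. norm (R *v x) \<le> norm x * C"
      using bounded_linear.bounded by blast
    have "integrable N (\<lambda>\<omega>. (norm (\<mu> + \<xi> \<omega> *\<^sub>R (R *v U \<omega>) - \<mu>))\<^sup>2)"
    proof (rule Bochner_Integration.integrable_bound)
      show "integrable N (\<lambda>\<omega>. (\<xi> \<omega>)\<^sup>2 * C\<^sup>2)" using \<xi>_int by simp
      have "AE \<omega> in N. norm (U \<omega>) = 1"
        by (rule AE_U[OF AE_uniform_sphere_norm]) measurable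
      then show "AE \<omega> in N. norm ((norm (\<mu> + \<xi> \<omega> *\<^sub>R (R *v U \<omega>) - \<mu>))\<^sup>2) \<le> norm ((\<xi> \<omega>)\<^sup>2 * C\<^sup>2)"
      proof eventually_elim
        case (elim \<omega>)
        then have "norm (R *v U \<omega>) \<le> C" using C[of "U \<omega>"] by simp
        then have "(norm (R *v U \<omega>))\<^sup>2 \<le> C\<^sup>2" by (intro power_mono) auto
        then show ?case by (simp add: power_mult_distrib mult_left_mono)
      qed
    qed measurable
    then have "integrable (distr M borel X) (\<lambda>x. (norm (x - \<mu>))\<^sup>2)"
      unfolding X_distr by (subst integrable_distr_eq) auto
    then show "integrable M (\<lambda>\<omega>. (norm (X \<omega> - \<mu>))\<^sup>2)"
      by (subst (asm) integrable_distr_eq) auto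
  next
    fix v :: "real^'d" assume "v \<noteq> 0"
    then have "R *v v \<noteq> 0" using R by (auto simp: positive_definite_def)
    show "\<not> (AE \<omega> in M. v \<bullet> (X \<omega> - \<mu>) = 0)"
    proof
      assume "AE \<omega> in M. v \<bullet> (X \<omega> - \<mu>) = 0"
      then have "AE \<omega> in N. v \<bullet> (\<mu> + \<xi> \<omega> *\<^sub>R (R *v U \<omega>) - \<mu>) = 0"
        using AE_X[of "\<lambda>x. v \<bullet> (x - \<mu>) = 0"] by simp
      moreover have "AE \<omega> in N. (R *v v) \<bullet> U \<omega> \<noteq> 0"
        by (rule AE_U[OF AE_uniform_sphere_hyperplane[OF \<open>R *v v \<noteq> 0\<close>]]) measurable
      ultimately have "AE \<omega> in N. (\<xi> \<omega>)\<^sup>2 = 0"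
        by eventually_elim (auto simp: inner_symmetric_matrix[OF R_sym])
      then have "(LINT \<omega>|N. (\<xi> \<omega>)\<^sup>2) = 0" by (rule integral_eq_zero_AE)
      with \<xi>_pos show False by simp
    qed
  next
    fix h :: "real^'d \<Rightarrow> ennreal" and i :: 'd
    assume [measurable]: "h \<in> borel_measurable borel"
    define n where "n = R *v (K *v axis i 1)"
    have R_n: "R *v n = axis i 1" by (simp add: n_def \<Sigma>_R[symmetric] \<Sigma>_K)
    have K_R: "(K *v (R *v u)) $ i = n \<bullet> u" for u
    proof -
      have "(K *v (R *v u)) $ i = axis i 1 \<bullet> (K *v (R *v u))" by (simp add: inner_axis')
      also have "\<dots> = n \<bullet> u"
        unfolding n_def by (simp only: inner_symmetric_matrix[OF K_sym] inner_symmetric_matrix[OF R_sym])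
      finally show ?thesis .
    qed
    have n_n: "n \<bullet> n = K $ i $ i"
      using K_R[of n] by (simp add: R_n matrix_vector_mul_component inner_axis)
    define A where "A x = x - (2 * (K *v (x - \<mu>)) $ i / K $ i $ i) *\<^sub>R axis i 1" for x
    have A_conj: "A (\<mu> + r *\<^sub>R (R *v u)) = \<mu> + r *\<^sub>R (R *v householder n u)" for r u
      by (simp add: A_def householder_def n_n K_R R_n matrix_vector_mult_diff_distrib
          matrix_vector_mult_scaleR algebra_simps)
    have [measurable]: "A \<in> borel_measurable borel"
      unfolding A_def by measurable
    have [measurable]: "householder n \<in> borel_measurable borel"
      unfolding householder_def[abs_def] by measurable
    have "(\<integral>\<^sup>+\<omega>. h (A (X \<omega>)) \<partial>M)
        = (\<integral>\<^sup>+r. \<integral>\<^sup>+u. h (\<mu> + r *\<^sub>R (R *v householder n u)) \<partial>uniform_sphere \<partial>distr N borel \<xi>)"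
      by (subst law) (auto simp: A_conj)
    also have "\<dots> = (\<integral>\<^sup>+r. \<integral>\<^sup>+u. h (\<mu> + r *\<^sub>R (R *v u)) \<partial>distr uniform_sphere borel (householder n) \<partial>distr N borel \<xi>)"
      by (subst nn_integral_distr) auto
    also have "\<dots> = (\<integral>\<^sup>+\<omega>. h (X \<omega>) \<partial>M)"
      by (simp add: distr_uniform_sphere_orthogonal[OF orthogonal_transformation_householder] law)
    finally show "(\<integral>\<^sup>+\<omega>. h (X \<omega> - (2 * (K *v (X \<omega> - \<mu>)) $ i / K $ i $ i) *\<^sub>R axis i 1) \<partial>M) = (\<integral>\<^sup>+\<omega>. h (X \<omega>) \<partial>M)"
      by (simp add: A_def)
  qed
qed

section \<open>Generated sigma-algebras, integrability and conditional expectation\<close>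

text \<open>
  Since \<open>y \<le> a\<close> holds exactly where \<open>f y \<le> f a\<close>, the sets generating the sigma-algebra of \<open>y\<close>
  are among those of \<open>f y\<close>. So conditioning on the \<open>Y\<^sub>k\<close> and on the \<open>f\<^sub>k(Y\<^sub>k)\<close> is the same.
\<close>
lemma borel_measurable_of_strict_mono_comp:
  fixes f :: "real \<Rightarrow> real"
  assumes f: "strict_mono f" and "(\<lambda>\<omega>. f (y \<omega>)) \<in> borel_measurable F"
  shows "y \<in> borel_measurable F"
proof -
  have "{\<omega> \<in> space F. y \<omega> \<le> a} = {\<omega> \<in> space F. f (y \<omega>) \<le> f a}" for a
    using f by (simp add: strict_mono_less_eq)
  then show ?thesis
    using assms(2) by (simp add: borel_measurable_iff_le)
qed

lemma subalgebra_vimage_algebra: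
  assumes "f \<in> measurable M N"
  shows "subalgebra M (vimage_algebra (space M) f N)"
  using measurable_space[OF assms] measurable_sets[OF assms]
  by (auto simp: subalgebra_def sets_vimage_algebra2 Pi_iff)

lemma (in prob_space) sigma_finite_subalgebraI: "subalgebra M F \<Longrightarrow> sigma_finite_subalgebra M F"
  by (intro finite_measure_subalgebra_is_sigma_finite finite_measure_subalgebra.intro
      finite_measure_subalgebra_axioms.intro) unfold_locales

lemma (in sigma_finite_subalgebra) cond_exp_exists_of_integrable:
  assumes "integrable M h"
  shows "cond_exp_exists M F h"
proof -
  have [measurable]: "h \<in> borel_measurable M" using assms by simp
  have "(\<integral>\<^sup>+\<omega>. nn_cond_exp M F (\<lambda>\<omega>. ennreal \<bar>h \<omega>\<bar>) \<omega> \<partial>M) = (\<integral>\<^sup>+\<omega>. ennreal \<bar>h \<omega>\<bar> \<partial>M)"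
    using nn_cond_exp_intg[of "\<lambda>_. 1" "\<lambda>\<omega>. ennreal \<bar>h \<omega>\<bar>"] by simp
  also have "\<dots> \<noteq> \<infinity>"
    using assms by (auto simp: integrable_iff_bounded)
  finally have "AE \<omega> in M. nn_cond_exp M F (\<lambda>\<omega>. ennreal \<bar>h \<omega>\<bar>) \<omega> \<noteq> \<infinity>"
    by (intro nn_integral_PInf_AE) simp
  then show ?thesis by (simp add: cond_exp_exists_def less_top)
qed

lemma integrable_mult_of_square_integrable:
  fixes A B :: "'a \<Rightarrow> real"
  assumes "integrable M (\<lambda>\<omega>. (A \<omega>)\<^sup>2)" "integrable M (\<lambda>\<omega>. (B \<omega>)\<^sup>2)"
    and [measurable]: "A \<in> borel_measurable M" "B \<in> borel_measurable M"
  shows "integrable M (\<lambda>\<omega>. A \<omega> * B \<omega>)"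
proof (rule Bochner_Integration.integrable_bound)
  show "integrable M (\<lambda>\<omega>. (A \<omega>)\<^sup>2 + (B \<omega>)\<^sup>2)" using assms by simp
  show "AE \<omega> in M. norm (A \<omega> * B \<omega>) \<le> norm ((A \<omega>)\<^sup>2 + (B \<omega>)\<^sup>2)"
  proof (intro AE_I2)
    fix \<omega>
    define p where "p = \<bar>A \<omega>\<bar> * \<bar>B \<omega>\<bar>"
    have "2 * p \<le> (A \<omega>)\<^sup>2 + (B \<omega>)\<^sup>2"
      using sum_squares_bound[of "\<bar>A \<omega>\<bar>" "\<bar>B \<omega>\<bar>"] by (simp add: p_def)
    moreover have "0 \<le> p" by (simp add: p_def)
    ultimately have "p \<le> (A \<omega>)\<^sup>2 + (B \<omega>)\<^sup>2" by linarith
    then show "norm (A \<omega> * B \<omega>) \<le> norm ((A \<omega>)\<^sup>2 + (B \<omega>)\<^sup>2)"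
      by (simp add: p_def abs_mult)
  qed
qed measurable

lemma (in finite_measure) integrable_of_square:
  "(\<lambda>\<omega>. A \<omega> :: real) \<in> borel_measurable M \<Longrightarrow> integrable M (\<lambda>\<omega>. (A \<omega>)\<^sup>2) \<Longrightarrow> integrable M A"
  using integrable_mult_of_square_integrable[of M A "\<lambda>_. 1"] by simp

lemma sigma_without_commute: "sigma_without M Y j i = sigma_without M Y i j"
  by (simp add: sigma_without_def insert_commute)

lemma sigma_without_coordinate:
  assumes "k \<notin> {i, j}"
  shows "(\<lambda>\<omega>. Y \<omega> $ k) \<in> borel_measurable (sigma_without M Y i j)"
proof -
  have "(\<lambda>\<omega>. (\<lambda>k\<in>- {i, j}. Y \<omega> $ k) k) \<in> borel_measurable (sigma_without M Y i j)"
    unfolding sigma_without_def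
    by (rule measurable_compose[OF measurable_vimage_algebra1 measurable_component_singleton])
       (use assms in \<open>auto simp: space_PiM\<close>)
  then show ?thesis using assms by simp
qed

section \<open>Regression on the coordinates outside a pair\<close>

context reflection_symmetric_vector
begin

definition others :: "'d \<Rightarrow> 'a measure" where
  "others i = vimage_algebra (space M) (\<lambda>\<omega>. \<lambda>k\<in>- {i}. X \<omega> $ k) (\<Pi>\<^sub>M k\<in>- {i}. borel)"

definition dual_coord :: "'d \<Rightarrow> 'a \<Rightarrow> real" where
  "dual_coord i \<omega> = (K *v (X \<omega> - \<mu>)) $ i"

text \<open>
  The residual of the linear regression of \<open>X\<^sub>i\<close> on the coordinates outside \<open>{i, j}\<close>. It is
  obtained by solving the two equations \<open>(K z)\<^sub>i = w\<^sub>i\<close>, \<open>(K z)\<^sub>j = w\<^sub>j\<close> for \<open>z\<^sub>i\<close>, up to a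
  linear function of the other coordinates of \<open>z = X - \<mu>\<close>.
\<close>
definition residual :: "'d \<Rightarrow> 'd \<Rightarrow> 'a \<Rightarrow> real" where
  "residual i j \<omega> = (K $ j $ j * dual_coord i \<omega> - K $ i $ j * dual_coord j \<omega>)
     / (K $ i $ i * K $ j $ j - (K $ i $ j)\<^sup>2)"

lemma K_sym: "K $ j $ i = K $ i $ j"
proof -
  have "transpose K $ i $ j = K $ i $ j" using K by (simp add: positive_definite_def)
  then show ?thesis by (simp add: transpose_def)
qed

lemma dual_coord_sum: "dual_coord i \<omega> = (\<Sum>k\<in>UNIV. K $ i $ k * (X \<omega> $ k - \<mu> $ k))"
  by (simp add: dual_coord_def matrix_vector_mult_def)

lemma dual_coord_measurable [measurable]: "dual_coord i \<in> borel_measurable M"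
  unfolding dual_coord_def[abs_def] by measurable

lemma residual_measurable [measurable]: "residual i j \<in> borel_measurable M"
  unfolding residual_def[abs_def] by measurable

lemma space_others [simp]: "space (others i) = space M"
  by (simp add: others_def)

lemma X_others:
  assumes "k \<noteq> i" shows "(\<lambda>\<omega>. X \<omega> $ k) \<in> borel_measurable (others i)"
proof -
  have "(\<lambda>\<omega>. (\<lambda>k\<in>- {i}. X \<omega> $ k) k) \<in> borel_measurable (others i)"
    unfolding others_def
    by (rule measurable_compose[OF measurable_vimage_algebra1 measurable_component_singleton])
       (use assms in \<open>auto simp: space_PiM\<close>)
  then show ?thesis using assms by simp
qed

lemma subalgebra_others: "subalgebra M (others i)"
  unfolding others_def by (rule subalgebra_vimage_algebra) (auto intro!: measurable_restrict)

text \<open>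
  Conditionally on all other coordinates of \<open>X\<close>, the law of \<open>(K (X - \<mu>))\<^sub>i\<close> is symmetric about
  \<open>0\<close>, because the \<open>i\<close>-th reflection reverses its sign and fixes those coordinates.
\<close>
lemma nn_integral_others_flip:
  assumes [measurable]: "B \<in> borel_measurable (others i)" "h \<in> borel_measurable borel"
  shows "(\<integral>\<^sup>+\<omega>. B \<omega> * h (dual_coord i \<omega>) \<partial>M) = (\<integral>\<^sup>+\<omega>. B \<omega> * (h (- dual_coord i \<omega>) :: ennreal) \<partial>M)"
proof -
  interpret G: sigma_finite_subalgebra M "others i"
    by (intro sigma_finite_subalgebraI subalgebra_others)
  let ?h = "\<lambda>\<omega>. h (dual_coord i \<omega>)" and ?h' = "\<lambda>\<omega>. h (- dual_coord i \<omega>)"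
  have set_flip: "(\<integral>\<^sup>+\<omega>\<in>A. ?h \<omega> \<partial>M) = (\<integral>\<^sup>+\<omega>\<in>A. ?h' \<omega> \<partial>M)" if "A \<in> sets (others i)" for A
  proof -
    have "A \<in> {(\<lambda>\<omega>. \<lambda>k\<in>- {i}. X \<omega> $ k) -` S \<inter> space M | S. S \<in> sets (\<Pi>\<^sub>M k\<in>- {i}. borel)}"
      using that unfolding others_def by (subst (asm) sets_vimage_algebra2) (auto simp: space_PiM)
    then obtain S where S[measurable]: "S \<in> sets (\<Pi>\<^sub>M k\<in>- {i}. borel)"
      and A: "A = (\<lambda>\<omega>. \<lambda>k\<in>- {i}. X \<omega> $ k) -` S \<inter> space M"
      by blast
    define r where "r x = (\<lambda>k\<in>- {i}. (x :: real^'d) $ k)" for x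
    have [measurable]: "r \<in> measurable borel (\<Pi>\<^sub>M k\<in>- {i}. borel)"
      unfolding r_def by (rule measurable_restrict) measurable
    define q where "q x = h (- (K *v (x - \<mu>)) $ i) * indicator S (r x)" for x
    have q_meas: "q \<in> borel_measurable borel"
      unfolding q_def by measurable
    define \<rho> where "\<rho> x = x - (2 * (K *v (x - \<mu>)) $ i / K $ i $ i) *\<^sub>R axis i 1" for x
    have r_\<rho>: "r (\<rho> x) = r x" for x
      by (auto simp: r_def \<rho>_def axis_def fun_eq_iff restrict_def)
    have "(K *v (\<rho> x - \<mu>)) $ i = - (K *v (x - \<mu>)) $ i" for x
    proof -
      have "\<rho> x - \<mu> = (x - \<mu>) - (2 * (K *v (x - \<mu>)) $ i / K $ i $ i) *\<^sub>R axis i 1"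
        by (simp add: \<rho>_def)
      then show ?thesis
        using positive_definite_diagonal_pos[OF K, of i]
        by (simp add: matrix_vector_mult_diff_distrib matrix_vector_mult_scaleR
            matrix_vector_mul_component[of K "axis i 1"] inner_axis)
    qed
    then have q_\<rho>: "q (\<rho> (X \<omega>)) = ?h \<omega> * indicator S (r (X \<omega>))" for \<omega>
      by (simp add: q_def r_\<rho> dual_coord_def)
    have ind: "indicator A \<omega> = (indicator S (r (X \<omega>)) :: ennreal)" if "\<omega> \<in> space M" for \<omega>
      using that by (simp add: A r_def indicator_def)
    have "(\<integral>\<^sup>+\<omega>\<in>A. ?h \<omega> \<partial>M) = (\<integral>\<^sup>+\<omega>. q (\<rho> (X \<omega>)) \<partial>M)"
      by (intro nn_integral_cong) (simp add: q_\<rho> ind)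
    also have "\<dots> = (\<integral>\<^sup>+\<omega>. q (X \<omega>) \<partial>M)"
      unfolding \<rho>_def by (rule reflection[OF q_meas])
    also have "\<dots> = (\<integral>\<^sup>+\<omega>\<in>A. ?h' \<omega> \<partial>M)"
      by (intro nn_integral_cong) (simp add: q_def dual_coord_def ind)
    finally show ?thesis .
  qed
  (* pass from indicators to an arbitrary weight B: both sides have the same conditional expectation *)
  have "AE \<omega> in M. nn_cond_exp M (others i) ?h' \<omega> = nn_cond_exp M (others i) ?h \<omega>"
  proof (rule G.nn_cond_exp_charact)
    fix A assume A: "A \<in> sets (others i)"
    have "(\<integral>\<^sup>+\<omega>\<in>A. nn_cond_exp M (others i) ?h' \<omega> \<partial>M) = (\<integral>\<^sup>+\<omega>\<in>A. ?h' \<omega> \<partial>M)"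
      using G.nn_cond_exp_intg[of "indicator A" ?h'] A by (simp add: mult.commute)
    then show "(\<integral>\<^sup>+\<omega>\<in>A. ?h \<omega> \<partial>M) = (\<integral>\<^sup>+\<omega>\<in>A. nn_cond_exp M (others i) ?h' \<omega> \<partial>M)"
      using set_flip[OF A] by simp
  qed measurable
  then have "(\<integral>\<^sup>+\<omega>. B \<omega> * nn_cond_exp M (others i) ?h' \<omega> \<partial>M) = (\<integral>\<^sup>+\<omega>. B \<omega> * nn_cond_exp M (others i) ?h \<omega> \<partial>M)"
    by (intro nn_integral_cong_AE) auto
  then show ?thesis
    using G.nn_cond_exp_intg[of B ?h] G.nn_cond_exp_intg[of B ?h'] by simp
qed

text \<open>
  The symmetry exchanges the positive and the negative part of \<open>(K (X - \<mu>))\<^sub>i B\<close>, so they have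
  the same conditional expectation. The argument compares nonnegative integrals and therefore
  covers products \<open>(K (X - \<mu>))\<^sub>i B\<close> that fail to be integrable.
\<close>
lemma real_cond_exp_dual_coord:
  assumes F: "subalgebra (others i) F" and B: "B \<in> borel_measurable (others i)"
  shows "AE \<omega> in M. real_cond_exp M F (\<lambda>\<omega>. dual_coord i \<omega> * B \<omega>) \<omega> = 0"
proof -
  have F_M: "subalgebra M F"
    using F subalgebra_others[of i] by (auto simp: subalgebra_def)
  interpret F: sigma_finite_subalgebra M F
    by (intro sigma_finite_subalgebraI F_M)
  note B[measurable]
  have [measurable]: "B \<in> borel_measurable M"
    by (rule measurable_from_subalg[OF subalgebra_others B])
  let ?p = "\<lambda>\<omega>. ennreal (dual_coord i \<omega> * B \<omega>)" and ?n = "\<lambda>\<omega>. ennreal (- (dual_coord i \<omega> * B \<omega>))"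
  have split: "ennreal (x * y) = ennreal y * ennreal x + ennreal (- y) * ennreal (- x)" for x y :: real
  proof -
    consider "0 \<le> x" "0 \<le> y" | "0 \<le> x" "y \<le> 0" | "x \<le> 0" "0 \<le> y" | "x \<le> 0" "y \<le> 0"
      by linarith
    then show ?thesis
    proof cases
      case 1 then show ?thesis by (simp add: ennreal_neg ennreal_mult mult.commute)
    next
      case 2 then show ?thesis by (simp add: ennreal_neg mult_nonneg_nonpos)
    next
      case 3 then show ?thesis by (simp add: ennreal_neg mult_nonpos_nonneg)
    next
      case 4 then show ?thesis using ennreal_mult[of "- y" "- x"] by (simp add: ennreal_neg mult.commute)
    qed
  qed
  have "AE \<omega> in M. nn_cond_exp M F ?n \<omega> = nn_cond_exp M F ?p \<omega>"
  proof (rule F.nn_cond_exp_charact)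
    fix A assume A: "A \<in> sets F"
    then have [measurable]: "A \<in> sets (others i)" "A \<in> sets M"
      using F F_M by (auto simp: subalgebra_def)
    let ?Bp = "\<lambda>\<omega>. indicator A \<omega> * ennreal (B \<omega>)" and ?Bn = "\<lambda>\<omega>. indicator A \<omega> * ennreal (- B \<omega>)"
    have "(\<integral>\<^sup>+\<omega>\<in>A. ?p \<omega> \<partial>M)
        = (\<integral>\<^sup>+\<omega>. ?Bp \<omega> * ennreal (dual_coord i \<omega>) + ?Bn \<omega> * ennreal (- dual_coord i \<omega>) \<partial>M)"
      by (intro nn_integral_cong, subst split) (simp add: algebra_simps)
    also have "\<dots> = (\<integral>\<^sup>+\<omega>. ?Bp \<omega> * ennreal (dual_coord i \<omega>) \<partial>M)
        + (\<integral>\<^sup>+\<omega>. ?Bn \<omega> * ennreal (- dual_coord i \<omega>) \<partial>M)"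
      by (rule nn_integral_add) measurable
    also have "\<dots> = (\<integral>\<^sup>+\<omega>. ?Bp \<omega> * ennreal (- dual_coord i \<omega>) \<partial>M)
        + (\<integral>\<^sup>+\<omega>. ?Bn \<omega> * ennreal (dual_coord i \<omega>) \<partial>M)"
      using nn_integral_others_flip[of ?Bp i ennreal]
        nn_integral_others_flip[of ?Bn i "\<lambda>x. ennreal (- x)"] by simp
    also have "\<dots> = (\<integral>\<^sup>+\<omega>. ?Bp \<omega> * ennreal (- dual_coord i \<omega>) + ?Bn \<omega> * ennreal (dual_coord i \<omega>) \<partial>M)"
      by (rule nn_integral_add[symmetric]) measurable
    also have "\<dots> = (\<integral>\<^sup>+\<omega>\<in>A. ?n \<omega> \<partial>M)"
      by (intro nn_integral_cong, subst mult_minus_left[symmetric], subst split) (simp add: algebra_simps)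
    also have "\<dots> = (\<integral>\<^sup>+\<omega>\<in>A. nn_cond_exp M F ?n \<omega> \<partial>M)"
      using F.nn_cond_exp_intg[of "indicator A" ?n] A by (simp add: mult.commute)
    finally show "(\<integral>\<^sup>+\<omega>\<in>A. ?p \<omega> \<partial>M) = (\<integral>\<^sup>+\<omega>\<in>A. nn_cond_exp M F ?n \<omega> \<partial>M)" .
  qed measurable
  then show ?thesis
    by eventually_elim (simp add: real_cond_exp_def)
qed

lemma square_integrable_inner: "integrable M (\<lambda>\<omega>. (v \<bullet> (X \<omega> - \<mu>))\<^sup>2)"
proof (rule Bochner_Integration.integrable_bound)
  show "integrable M (\<lambda>\<omega>. (norm v)\<^sup>2 * (norm (X \<omega> - \<mu>))\<^sup>2)" using square_integrable by simp
  show "AE \<omega> in M. norm ((v \<bullet> (X \<omega> - \<mu>))\<^sup>2) \<le> norm ((norm v)\<^sup>2 * (norm (X \<omega> - \<mu>))\<^sup>2)"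
    using power_mono[OF Cauchy_Schwarz_ineq2 abs_ge_zero, of _ _ 2] by (auto simp: power_mult_distrib)
qed measurable

lemma dual_coord_inner: "dual_coord i \<omega> = row i K \<bullet> (X \<omega> - \<mu>)"
  by (simp add: dual_coord_def matrix_vector_mul_component row_def)

lemma square_integrable_dual_coord: "integrable M (\<lambda>\<omega>. (dual_coord i \<omega>)\<^sup>2)"
  by (simp add: dual_coord_inner square_integrable_inner)

text \<open>The vector \<open>v\<close> is nonzero because \<open>X\<^sub>i\<close> enters its own residual with coefficient \<open>1\<close>.\<close>
lemma residual_inner:
  assumes "i \<noteq> j"
  obtains v where "v \<noteq> 0" and "\<And>\<omega>. residual i j \<omega> = v \<bullet> (X \<omega> - \<mu>)"
proof
  let ?D = "K $ i $ i * K $ j $ j - (K $ i $ j)\<^sup>2"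
  define v where "v = (1 / ?D) *\<^sub>R (K $ j $ j *\<^sub>R row i K - K $ i $ j *\<^sub>R row j K)"
  have "?D \<noteq> 0" using positive_definite_minor_pos[OF K assms] by simp
  then have "v $ i = 1"
    by (simp add: v_def row_def K_sym[of j i] power2_eq_square mult.commute)
  then show "v \<noteq> 0" by auto
  show "residual i j \<omega> = v \<bullet> (X \<omega> - \<mu>)" for \<omega>
    by (simp add: v_def residual_def dual_coord_inner inner_diff_left)
qed

lemma square_integrable_residual: "i \<noteq> j \<Longrightarrow> integrable M (\<lambda>\<omega>. (residual i j \<omega>)\<^sup>2)"
  by (rule residual_inner[of i j]) (auto simp: square_integrable_inner)

lemma integrable_dual_coord: "integrable M (dual_coord i)"
  by (rule integrable_of_square[OF _ square_integrable_dual_coord]) measurable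

lemma integrable_residual: "i \<noteq> j \<Longrightarrow> integrable M (residual i j)"
  by (rule integrable_of_square[OF _ square_integrable_residual]) measurable

lemma integrable_X: "integrable M (\<lambda>\<omega>. X \<omega> $ k)"
proof -
  have "integrable M (\<lambda>\<omega>. axis k 1 \<bullet> (X \<omega> - \<mu>))"
    by (rule integrable_of_square[OF _ square_integrable_inner]) measurable
  then have "integrable M (\<lambda>\<omega>. (X \<omega> $ k - \<mu> $ k) + \<mu> $ k)"
    by (intro Bochner_Integration.integrable_add) (simp_all add: inner_axis')
  then show ?thesis by simp
qed

text \<open>
  In \<open>K\<^sub>j\<^sub>j (K z)\<^sub>i - K\<^sub>i\<^sub>j (K z)\<^sub>j\<close> the coordinate \<open>z\<^sub>j\<close> cancels and \<open>z\<^sub>i\<close> has the minor as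
  coefficient. Hence the fitted value \<open>X\<^sub>i - residual i j\<close> is a function of the other
  coordinates.
\<close>
lemma residual_expansion:
  assumes "i \<noteq> j"
  shows "X \<omega> $ i - residual i j \<omega> = \<mu> $ i -
    (\<Sum>k\<in>- {i, j}. (K $ j $ j * K $ i $ k - K $ i $ j * K $ j $ k)
       / (K $ i $ i * K $ j $ j - (K $ i $ j)\<^sup>2) * (X \<omega> $ k - \<mu> $ k))"
proof -
  let ?D = "K $ i $ i * K $ j $ j - (K $ i $ j)\<^sup>2"
  have D: "?D \<noteq> 0" using positive_definite_minor_pos[OF K assms] by simp
  let ?z = "\<lambda>k. X \<omega> $ k - \<mu> $ k"
  have dual: "dual_coord l \<omega> = K $ l $ i * ?z i + K $ l $ j * ?z j + (\<Sum>k\<in>- {i, j}. K $ l $ k * ?z k)" for l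
  proof -
    have "dual_coord l \<omega> = (\<Sum>k\<in>insert i (insert j (- {i, j})). K $ l $ k * ?z k)"
      unfolding dual_coord_sum by (rule sum.cong) auto
    then show ?thesis using assms by (simp add: add.assoc)
  qed
  have rest: "(\<Sum>k\<in>- {i, j}. (K $ j $ j * K $ i $ k - K $ i $ j * K $ j $ k) * ?z k)
      = K $ j $ j * (\<Sum>k\<in>- {i, j}. K $ i $ k * ?z k) - K $ i $ j * (\<Sum>k\<in>- {i, j}. K $ j $ k * ?z k)"
    by (simp only: sum_distrib_left sum_subtractf left_diff_distrib mult.assoc)
  have "residual i j \<omega> * ?D = K $ j $ j * dual_coord i \<omega> - K $ i $ j * dual_coord j \<omega>"
    using D by (simp add: residual_def)
  also have "\<dots> = ?z i * ?D + (\<Sum>k\<in>- {i, j}. (K $ j $ j * K $ i $ k - K $ i $ j * K $ j $ k) * ?z k)"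
    unfolding dual rest by (simp only: K_sym[of j i] power2_eq_square) algebra
  finally have "residual i j \<omega> = ?z i + (\<Sum>k\<in>- {i, j}. (K $ j $ j * K $ i $ k - K $ i $ j * K $ j $ k) * ?z k) / ?D"
    using D by (simp add: field_simps)
  then show ?thesis by (simp add: sum_divide_distrib)
qed

lemma dual_coord_residual:
  assumes "i \<noteq> j"
  shows "dual_coord i \<omega> = K $ i $ i * residual i j \<omega> + K $ i $ j * residual j i \<omega>"
proof -
  define D where "D = K $ i $ i * K $ j $ j - (K $ i $ j)\<^sup>2"
  have "D \<noteq> 0" using positive_definite_minor_pos[OF K assms] by (simp add: D_def)
  have "residual i j \<omega> * D = K $ j $ j * dual_coord i \<omega> - K $ i $ j * dual_coord j \<omega>"
    "residual j i \<omega> * D = K $ i $ i * dual_coord j \<omega> - K $ i $ j * dual_coord i \<omega>"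
    using \<open>D \<noteq> 0\<close> by (simp_all add: residual_def D_def K_sym[of i j] mult.commute)
  then have "dual_coord i \<omega> * D = (K $ i $ i * residual i j \<omega> + K $ i $ j * residual j i \<omega>) * D"
    unfolding D_def by algebra
  with \<open>D \<noteq> 0\<close> show ?thesis by simp
qed

lemma fitted_measurable:
  assumes "i \<noteq> j" and "\<And>k. k \<notin> {i, j} \<Longrightarrow> (\<lambda>\<omega>. X \<omega> $ k) \<in> borel_measurable F"
  shows "(\<lambda>\<omega>. X \<omega> $ i - residual i j \<omega>) \<in> borel_measurable F"
  unfolding residual_expansion[OF assms(1)]
  by (intro borel_measurable_diff borel_measurable_sum borel_measurable_times borel_measurable_const assms(2)) auto

text \<open>
  The fitted value is \<open>F\<close>-measurable, and the residual is a combination of two dual coordinates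
  whose conditional expectations given \<open>F\<close> vanish. So the linear regression is the conditional
  expectation.
\<close>
lemma cond_centered_X:
  assumes "i \<noteq> j" and Fi: "subalgebra (others i) F" and Fj: "subalgebra (others j) F"
    and XF: "\<And>k. k \<notin> {i, j} \<Longrightarrow> (\<lambda>\<omega>. X \<omega> $ k) \<in> borel_measurable F"
  shows "AE \<omega> in M. cond_centered M F (\<lambda>\<omega>. X \<omega> $ i) \<omega> = residual i j \<omega>"
proof -
  have F_M: "subalgebra M F"
    using Fi subalgebra_others[of i] by (auto simp: subalgebra_def)
  interpret F: sigma_finite_subalgebra M F
    by (intro sigma_finite_subalgebraI F_M)
  let ?D = "K $ i $ i * K $ j $ j - (K $ i $ j)\<^sup>2"
  let ?a = "K $ j $ j / ?D" and ?b = "K $ i $ j / ?D"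
  have res: "residual i j = (\<lambda>\<omega>. ?a * dual_coord i \<omega> - ?b * dual_coord j \<omega>)"
    by (simp add: residual_def diff_divide_distrib fun_eq_iff)
  have dual_i: "AE \<omega> in M. real_cond_exp M F (dual_coord i) \<omega> = 0"
    using real_cond_exp_dual_coord[OF Fi, of "\<lambda>_. 1"] by simp
  have dual_j: "AE \<omega> in M. real_cond_exp M F (dual_coord j) \<omega> = 0"
    using real_cond_exp_dual_coord[OF Fj, of "\<lambda>_. 1"] by simp
  have "AE \<omega> in M. real_cond_exp M F (residual i j) \<omega>
      = real_cond_exp M F (\<lambda>\<omega>. ?a * dual_coord i \<omega>) \<omega> - real_cond_exp M F (\<lambda>\<omega>. ?b * dual_coord j \<omega>) \<omega>"
    unfolding res by (rule F.real_cond_exp_diff) (simp_all add: integrable_dual_coord)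
  with F.real_cond_exp_cmult[OF integrable_dual_coord, of ?a i]
    F.real_cond_exp_cmult[OF integrable_dual_coord, of ?b j] dual_i dual_j
  have residual_0: "AE \<omega> in M. real_cond_exp M F (residual i j) \<omega> = 0"
    by eventually_elim simp
  have "AE \<omega> in M. real_cond_exp M F (\<lambda>\<omega>. X \<omega> $ i - residual i j \<omega>) \<omega> = X \<omega> $ i - residual i j \<omega>"
    by (intro F.real_cond_exp_F_meas fitted_measurable[OF assms(1) XF] Bochner_Integration.integrable_diff
        integrable_X integrable_residual[OF assms(1)])
  moreover have "AE \<omega> in M. real_cond_exp M F (\<lambda>\<omega>. X \<omega> $ i - residual i j \<omega>) \<omega>
      = real_cond_exp M F (\<lambda>\<omega>. X \<omega> $ i) \<omega> - real_cond_exp M F (residual i j) \<omega>"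
    by (intro F.real_cond_exp_diff integrable_X integrable_residual[OF assms(1)])
  ultimately show ?thesis using residual_0
    by eventually_elim (simp add: cond_centered_def)
qed

text \<open>
  Being \<open>X\<^sub>j\<close> minus its fitted value, the residual of \<open>X\<^sub>j\<close> is a function of the coordinates
  other than the \<open>i\<close>-th, so the sign symmetry of \<open>(K (X - \<mu>))\<^sub>i\<close> applies.
\<close>
lemma orthogonal_dual_residual:
  assumes "i \<noteq> j"
  shows "(LINT \<omega>|M. dual_coord i \<omega> * residual j i \<omega>) = 0"
proof -
  interpret G: sigma_finite_subalgebra M "others i"
    by (intro sigma_finite_subalgebraI subalgebra_others)
  have "(\<lambda>\<omega>. X \<omega> $ j - (X \<omega> $ j - residual j i \<omega>)) \<in> borel_measurable (others i)"
    using assms by (intro borel_measurable_diff X_others fitted_measurable) auto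
  then have "AE \<omega> in M. real_cond_exp M (others i) (\<lambda>\<omega>. dual_coord i \<omega> * residual j i \<omega>) \<omega> = 0"
    by (intro real_cond_exp_dual_coord) (auto simp: subalgebra_def)
  then have "(LINT \<omega>|M. real_cond_exp M (others i) (\<lambda>\<omega>. dual_coord i \<omega> * residual j i \<omega>) \<omega>) = 0"
    by (rule integral_eq_zero_AE)
  moreover have "integrable M (\<lambda>\<omega>. dual_coord i \<omega> * residual j i \<omega>)"
    using assms
    by (intro integrable_mult_of_square_integrable square_integrable_residual square_integrable_dual_coord) auto
  ultimately show ?thesis using G.real_cond_exp_int(2) by simp
qed

lemma residual_square_pos:
  assumes "i \<noteq> j"
  shows "0 < (LINT \<omega>|M. (residual i j \<omega>)\<^sup>2)"
proof -
  obtain v where v: "v \<noteq> 0" "\<And>\<omega>. residual i j \<omega> = v \<bullet> (X \<omega> - \<mu>)"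
    using residual_inner[OF assms] by blast
  have "(LINT \<omega>|M. (residual i j \<omega>)\<^sup>2) \<noteq> 0"
    using nondegenerate[OF v(1)]
    by (subst integral_nonneg_eq_0_iff_AE) (auto simp: square_integrable_inner v(2))
  then show ?thesis by (simp add: less_le)
qed

text \<open>
  Write \<open>r\<^sub>i\<close>, \<open>r\<^sub>j\<close> for the two residuals. Since \<open>(K (X - \<mu>))\<^sub>i = K\<^sub>i\<^sub>i r\<^sub>i + K\<^sub>i\<^sub>j r\<^sub>j\<close>
  is orthogonal to \<open>r\<^sub>j\<close>, one has \<open>K\<^sub>i\<^sub>i E(r\<^sub>i r\<^sub>j) = - K\<^sub>i\<^sub>j E(r\<^sub>j\<^sup>2)\<close>, and both
  \<open>K\<^sub>i\<^sub>i\<close> and \<open>E(r\<^sub>j\<^sup>2)\<close> are positive.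
\<close>
lemma precision_entry_zero_iff:
  assumes "i \<noteq> j"
  shows "K $ i $ j = 0 \<longleftrightarrow> (LINT \<omega>|M. residual i j \<omega> * residual j i \<omega>) = 0"
proof -
  have int: "integrable M (\<lambda>\<omega>. residual i j \<omega> * residual j i \<omega>)"
    using assms by (intro integrable_mult_of_square_integrable square_integrable_residual) auto
  have "0 = (LINT \<omega>|M. K $ i $ i * (residual i j \<omega> * residual j i \<omega>) + K $ i $ j * (residual j i \<omega>)\<^sup>2)"
    using orthogonal_dual_residual[OF assms]
    by (simp add: dual_coord_residual[OF assms] algebra_simps power2_eq_square)
  also have "\<dots> = K $ i $ i * (LINT \<omega>|M. residual i j \<omega> * residual j i \<omega>)
      + K $ i $ j * (LINT \<omega>|M. (residual j i \<omega>)\<^sup>2)"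
    using int square_integrable_residual[of j i] assms by simp
  finally show ?thesis
    using positive_definite_diagonal_pos[OF K, of i] residual_square_pos[of j i] assms by auto
qed

section \<open>Conditional covariance and the precision matrix\<close>

lemma subalgebra_sigma_without:
  assumes f: "\<And>k. strict_mono (f k)" and XY: "\<And>\<omega> k. X \<omega> $ k = f k (Y \<omega> $ k)"
  shows "subalgebra (others i) (sigma_without M Y i j)"
proof -
  have "(\<lambda>\<omega>. Y \<omega> $ k) \<in> borel_measurable (others i)" if "k \<noteq> i" for k
    using borel_measurable_of_strict_mono_comp[OF f[of k]] X_others[OF that] by (simp add: XY)
  then have "(\<lambda>\<omega>. \<lambda>k\<in>- {i, j}. Y \<omega> $ k) \<in> measurable (others i) (\<Pi>\<^sub>M k\<in>- {i, j}. borel)"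
    by (intro measurable_restrict) auto
  from subalgebra_vimage_algebra[OF this] show ?thesis
    by (simp add: sigma_without_def)
qed

text \<open>
  For \<open>K\<^sub>i\<^sub>j = 0\<close> the residual of \<open>X\<^sub>i\<close> is \<open>(K (X - \<mu>))\<^sub>i / K\<^sub>i\<^sub>i\<close>, whose product with any
  function of the remaining coordinates is conditionally centered.
\<close>
lemma cond_cov_zero_of_precision_zero:
  assumes "i \<noteq> j" and K0: "K $ i $ j = 0"
    and Fi: "subalgebra (others i) F" and Fj: "subalgebra (others j) F"
    and XF: "\<And>k. k \<notin> {i, j} \<Longrightarrow> (\<lambda>\<omega>. X \<omega> $ k) \<in> borel_measurable F"
    and B: "B \<in> borel_measurable (others i)"
  shows "AE \<omega> in M. cond_cov M F (\<lambda>\<omega>. X \<omega> $ i) B \<omega> = 0"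
proof -
  have F_M: "subalgebra M F"
    using Fi subalgebra_others[of i] by (auto simp: subalgebra_def)
  interpret F: sigma_finite_subalgebra M F
    by (intro sigma_finite_subalgebraI F_M)
  have "cond_centered M F B \<in> borel_measurable (others i)"
    unfolding cond_centered_def
    by (intro borel_measurable_diff B measurable_from_subalg[OF Fi]) measurable
  then have B'[measurable]: "(\<lambda>\<omega>. cond_centered M F B \<omega> / K $ i $ i) \<in> borel_measurable (others i)"
    by measurable
  have [measurable]: "(\<lambda>\<omega>. cond_centered M F B \<omega>) \<in> borel_measurable M"
    by (rule measurable_from_subalg[OF subalgebra_others]) fact
  have [measurable]: "cond_centered M F (\<lambda>\<omega>. X \<omega> $ i) \<in> borel_measurable M"
    unfolding cond_centered_def by measurable
  have "residual i j \<omega> = dual_coord i \<omega> / K $ i $ i" for \<omega>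
    using dual_coord_residual[OF \<open>i \<noteq> j\<close>, of \<omega>] positive_definite_diagonal_pos[OF K, of i] K0 by simp
  moreover have "AE \<omega> in M. cond_centered M F (\<lambda>\<omega>. X \<omega> $ i) \<omega> = residual i j \<omega>"
    by (rule cond_centered_X[OF \<open>i \<noteq> j\<close> Fi Fj XF])
  ultimately have eq: "AE \<omega> in M. cond_centered M F (\<lambda>\<omega>. X \<omega> $ i) \<omega> * cond_centered M F B \<omega>
      = dual_coord i \<omega> * (cond_centered M F B \<omega> / K $ i $ i)"
    by (auto elim!: eventually_mono)
  have "AE \<omega> in M. cond_cov M F (\<lambda>\<omega>. X \<omega> $ i) B \<omega>
      = real_cond_exp M F (\<lambda>\<omega>. dual_coord i \<omega> * (cond_centered M F B \<omega> / K $ i $ i)) \<omega>"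
    unfolding cond_cov_def by (rule F.real_cond_exp_cong[OF eq]) measurable
  with real_cond_exp_dual_coord[OF Fi B'] show ?thesis
    by eventually_elim simp
qed

text \<open>
  The expectation of the conditional covariance of \<open>X\<^sub>i\<close> and \<open>X\<^sub>j\<close> is the expected product of
  their residuals.
\<close>
lemma
  assumes "i \<noteq> j"
    and Fi: "subalgebra (others i) F" and Fj: "subalgebra (others j) F"
    and XF: "\<And>k. k \<notin> {i, j} \<Longrightarrow> (\<lambda>\<omega>. X \<omega> $ k) \<in> borel_measurable F"
  shows cond_cov_exists_coordinates: "cond_cov_exists M F (\<lambda>\<omega>. X \<omega> $ i) (\<lambda>\<omega>. X \<omega> $ j)"
    and precision_zero_of_cond_cov_zero:
      "(AE \<omega> in M. cond_cov M F (\<lambda>\<omega>. X \<omega> $ i) (\<lambda>\<omega>. X \<omega> $ j) \<omega> = 0) \<Longrightarrow> K $ i $ j = 0"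
proof -
  have F_M: "subalgebra M F"
    using Fi subalgebra_others[of i] by (auto simp: subalgebra_def)
  interpret F: sigma_finite_subalgebra M F
    by (intro sigma_finite_subalgebraI F_M)
  let ?C = "\<lambda>k. cond_centered M F (\<lambda>\<omega>. X \<omega> $ k)"
  have C_meas[measurable]: "?C k \<in> borel_measurable M" for k
    unfolding cond_centered_def by measurable
  have "AE \<omega> in M. ?C j \<omega> = residual j i \<omega>"
    using cond_centered_X[of j i F] assms by (auto simp: insert_commute)
  moreover have "AE \<omega> in M. ?C i \<omega> = residual i j \<omega>"
    by (rule cond_centered_X[OF \<open>i \<noteq> j\<close> Fi Fj XF])
  ultimately have eq: "AE \<omega> in M. ?C i \<omega> * ?C j \<omega> = residual i j \<omega> * residual j i \<omega>"
    by eventually_elim simp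
  have "integrable M (\<lambda>\<omega>. residual i j \<omega> * residual j i \<omega>)"
    using \<open>i \<noteq> j\<close> by (intro integrable_mult_of_square_integrable square_integrable_residual) auto
  then have int: "integrable M (\<lambda>\<omega>. ?C i \<omega> * ?C j \<omega>)"
    using eq by (subst integrable_cong_AE) auto
  then show "cond_cov_exists M F (\<lambda>\<omega>. X \<omega> $ i) (\<lambda>\<omega>. X \<omega> $ j)"
    unfolding cond_cov_exists_def
    by (intro conjI F.cond_exp_exists_of_integrable integrable_X)
  assume "AE \<omega> in M. cond_cov M F (\<lambda>\<omega>. X \<omega> $ i) (\<lambda>\<omega>. X \<omega> $ j) \<omega> = 0"
  then have "0 = (LINT \<omega>|M. cond_cov M F (\<lambda>\<omega>. X \<omega> $ i) (\<lambda>\<omega>. X \<omega> $ j) \<omega>)"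
    by (intro integral_eq_zero_AE[symmetric])
  also have "\<dots> = (LINT \<omega>|M. ?C i \<omega> * ?C j \<omega>)"
    unfolding cond_cov_def by (rule F.real_cond_exp_int(2)[OF int])
  also have "\<dots> = (LINT \<omega>|M. residual i j \<omega> * residual j i \<omega>)"
    by (rule integral_cong_AE[OF _ _ eq]) measurable
  finally show "K $ i $ j = 0"
    using precision_entry_zero_iff[OF \<open>i \<noteq> j\<close>] by simp
qed

end

theorem theorem3p5:
  fixes M :: "'a measure"
    and Y :: "'a \<Rightarrow> real^'d"
    and f :: "'d \<Rightarrow> real \<Rightarrow> real"
    and \<mu> :: "real^'d"
    and \<Sigma> K :: "real^'d^'d"
    and i j :: 'd
  assumes "CARD('d) \<ge> 2"
    and "positive_definite \<Sigma>"
    and "K = matrix_inv \<Sigma>"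
    and "transelliptical M Y f \<mu> \<Sigma>"
    and "square_integrable_radius M (\<lambda>\<omega>. \<chi> k. f k (Y \<omega> $ k)) \<mu> \<Sigma>"
    and "i \<noteq> j"
  shows "K $ i $ j = 0 \<longleftrightarrow>
    (\<forall>g \<in> borel_measurable borel.
       cond_cov_exists M (sigma_without M Y i j)
         (\<lambda>\<omega>. f i (Y \<omega> $ i)) (\<lambda>\<omega>. g (Y \<omega> $ j)) \<longrightarrow>
       (AE \<omega> in M. cond_cov M (sigma_without M Y i j)
         (\<lambda>\<omega>. f i (Y \<omega> $ i)) (\<lambda>\<omega>. g (Y \<omega> $ j)) \<omega> = 0))"
proof -
  let ?F = "sigma_without M Y i j"
  define X where "X \<omega> = (\<chi> k. f k (Y \<omega> $ k))" for \<omega>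
  have XY: "X \<omega> $ k = f k (Y \<omega> $ k)" for \<omega> k by (simp add: X_def)
  have f: "strict_mono (f k)" for k
    using assms(4) by (simp add: transelliptical_def)
  have f_borel [measurable]: "f k \<in> borel_measurable borel" for k
    by (rule borel_measurable_mono[OF strict_mono_mono[OF f]])
  have "prob_space M" "X \<in> borel_measurable M"
    using assms(4) by (simp_all add: transelliptical_def elliptical_def X_def[abs_def])
  then interpret reflection_symmetric_vector M X \<mu> K
    using assms(2,3,5) reflection_symmetric_vector_of_square_integrable_radius[of M X \<Sigma> \<mu>]
    by (simp add: X_def[abs_def])
  have Fi: "subalgebra (others i) ?F" and Fj: "subalgebra (others j) ?F"
    using subalgebra_sigma_without[OF f XY, of i j] subalgebra_sigma_without[OF f XY, of j i]
    by (simp_all add: sigma_without_commute)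
  have XF: "(\<lambda>\<omega>. X \<omega> $ k) \<in> borel_measurable ?F" if "k \<notin> {i, j}" for k
    unfolding XY by (rule measurable_compose[OF sigma_without_coordinate[OF that] f_borel])
  show ?thesis
    unfolding XY[symmetric]
  proof (intro iffI ballI impI)
    fix g :: "real \<Rightarrow> real"
    assume "K $ i $ j = 0" and [measurable]: "g \<in> borel_measurable borel"
    have "(\<lambda>\<omega>. Y \<omega> $ j) \<in> borel_measurable (others i)"
      using borel_measurable_of_strict_mono_comp[OF f[of j]] X_others[of j i] \<open>i \<noteq> j\<close> by (simp add: XY)
    then have "(\<lambda>\<omega>. g (Y \<omega> $ j)) \<in> borel_measurable (others i)"
      by measurable
    then show "AE \<omega> in M. cond_cov M ?F (\<lambda>\<omega>. X \<omega> $ i) (\<lambda>\<omega>. g (Y \<omega> $ j)) \<omega> = 0"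
      by (intro cond_cov_zero_of_precision_zero[OF \<open>i \<noteq> j\<close> \<open>K $ i $ j = 0\<close> Fi Fj XF])
  next
    assume *: "\<forall>g\<in>borel_measurable borel. cond_cov_exists M ?F (\<lambda>\<omega>. X \<omega> $ i) (\<lambda>\<omega>. g (Y \<omega> $ j)) \<longrightarrow>
      (AE \<omega> in M. cond_cov M ?F (\<lambda>\<omega>. X \<omega> $ i) (\<lambda>\<omega>. g (Y \<omega> $ j)) \<omega> = 0)"
    (* the test function g = f j turns g (Y j) into X j *)
    show "K $ i $ j = 0"
      using *[rule_format, OF f_borel[of j]] cond_cov_exists_coordinates[OF \<open>i \<noteq> j\<close> Fi Fj XF]
        precision_zero_of_cond_cov_zero[OF \<open>i \<noteq> j\<close> Fi Fj XF] by (simp add: XY)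
  qed
qed

end
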